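(* Consider a finite set of positions with finite coverage ratios $\Gamma_i$, totally ordered deadline timestamps, and unique deterministic identifiers. Then the canonical lexicographic rule (ascending $\Gamma_i$, then earliest hard-flat deadline, then position identifier) produces a unique execution order. If exact $\Gamma_i$ and deadline ties are grouped for pro-rata processing, the ordered sequence of tie cohorts is unique and any indivisible-lot residual is uniquely assigned by identifier.
   Context: Each position $i$ carries a real number $\Gamma_i$ (its standalone robust coverage ratio, $\Gamma_i=(K_i+\underline B^{\mathrm{standalone}}_i(q_i))/(\overline H_i+m_i)$, i.e. cash plus a lower bound on full-liquidation proceeds divided by the debt-service upper bound plus buffer), a deadline timestamp in a totally ordered set (different positions may share a deadline), and an identifier in a totally ordered set, with distinct positions having distinct identifiers. The canonical rule orders positions lexicographically by the tuple $(\Gamma_i,\mathrm{deadline}_i,\mathrm{identifier}_i)$, smallest first. A tie cohort is a maximal set of positions having equal $\Gamma_i$ and equal deadline; cohorts are ordered lexicographically by $(\Gamma,\mathrm{deadline})$. Within a cohort, sale targets are pro rata to debt-service requirement and any residual caused by indivisible lots is assigned following the identifier order. *)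

theory Defs
  imports Complex_Main "HOL-Library.Product_Lexorder" "HOL-Library.Sublist"
begin

(* The requirement used as pro-rata weight is kept separate from the upper bound in the
   coverage ratio, so that either that bound or any other measure can be used as the weight. *)
record ('q, 'd, 'i) position =
  cash :: real
  quantity :: 'q
  standalone_proceeds_lb :: "'q \<Rightarrow> real"
  debt_service_ub :: real
  buffer :: real
  debt_service_requirement :: real
  deadline :: 'd
  position_id :: 'i

definition coverage_ratio :: "('q, 'd, 'i) position \<Rightarrow> real" where
  "coverage_ratio p =
     (cash p + standalone_proceeds_lb p (quantity p)) / (debt_service_ub p + buffer p)"

(* The order on tuples is the lexicographic one of Product_Lexorder. *)
definition canonical_key :: "('q, 'd, 'i) position \<Rightarrow> real \<times> 'd \<times> 'i" where
  "canonical_key p = (coverage_ratio p, deadline p, position_id p)"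

definition tie_key :: "('q, 'd, 'i) position \<Rightarrow> real \<times> 'd" where
  "tie_key p = (coverage_ratio p, deadline p)"

(* A non-strict sortedness condition: by itself it does not exclude ties, so uniqueness
   of such a list is not built into the definition. *)
definition execution_order ::
  "('q, 'd::linorder, 'i::linorder) position set \<Rightarrow> ('q, 'd, 'i) position list \<Rightarrow> bool" where
  "execution_order P xs \<longleftrightarrow> distinct xs \<and> set xs = P \<and> sorted (map canonical_key xs)"

definition tied :: "('q, 'd, 'i) position set \<Rightarrow> bool" where
  "tied C \<longleftrightarrow> (\<forall>p\<in>C. \<forall>q\<in>C. coverage_ratio p = coverage_ratio q \<and> deadline p = deadline q)"

definition tie_cohorts :: "('q, 'd, 'i) position set \<Rightarrow> ('q, 'd, 'i) position set set" where
  "tie_cohorts P =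
     {C. C \<subseteq> P \<and> C \<noteq> {} \<and> tied C \<and> (\<forall>C'. C \<subseteq> C' \<and> C' \<subseteq> P \<and> tied C' \<longrightarrow> C' = C)}"

definition cohort_sequence ::
  "('q, 'd::linorder, 'i) position set \<Rightarrow> ('q, 'd, 'i) position set list \<Rightarrow> bool" where
  "cohort_sequence P Cs \<longleftrightarrow>
     distinct Cs \<and> set Cs = tie_cohorts P \<and>
     sorted_wrt (\<lambda>C D. \<forall>p\<in>C. \<forall>q\<in>D. tie_key p \<le> tie_key q) Cs"

(* Share of position p in a sale of n lots by the cohort C, measured in (fractional) lots. *)
definition pro_rata_target ::
  "nat \<Rightarrow> ('q, 'd, 'i) position set \<Rightarrow> ('q, 'd, 'i) position \<Rightarrow> real" where
  "pro_rata_target n C p =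
     real n * debt_service_requirement p / (\<Sum>q\<in>C. debt_service_requirement q)"

definition base_lots ::
  "nat \<Rightarrow> ('q, 'd, 'i) position set \<Rightarrow> ('q, 'd, 'i) position \<Rightarrow> nat" where
  "base_lots n C p = nat \<lfloor>pro_rata_target n C p\<rfloor>"

definition identifier_order ::
  "('q, 'd, 'i::linorder) position set \<Rightarrow> ('q, 'd, 'i) position list \<Rightarrow> bool" where
  "identifier_order C xs \<longleftrightarrow> distinct xs \<and> set xs = C \<and> sorted (map position_id xs)"

(* Rounding every target down leaves a residual of whole lots, which are handed out one at
   a time following the identifier order: the j-th residual lot goes to rs ! j. With
   nonnegative weights of positive sum the residual is smaller than the cohort. *)
definition residual_assignment ::
  "nat \<Rightarrow> ('q, 'd, 'i::linorder) position set \<Rightarrow> ('q, 'd, 'i) position list \<Rightarrow> bool" where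
  "residual_assignment n C rs \<longleftrightarrow>
     (\<Sum>p\<in>C. base_lots n C p) + length rs = n \<and>
     (\<exists>xs. identifier_order C xs \<and> prefix rs xs)"

end

theory Submission
  imports Defs
begin

text \<open>All three claims rest on one fact: a finite set with an injective key into a linear
  order has exactly one enumeration sorted by that key (\<open>ex1_sorted_key_list\<close>). For
  positions the key is \<open>canonical_key\<close>, injective because its last component is the
  identifier. For cohorts it is the tie key shared by the members: a cohort is a full fibre of
  \<open>tie_key\<close> in P, so this key determines it (\<open>tie_cohort_eq\<close>,
  \<open>inj_on_cohort_key\<close>). For residual lots, the identifier order of a cohort is unique
  by the same fact, and the recipients form a prefix of it whose length is forced by the lot count;
  rounding leaves at most one lot per position (\<open>base_lots_bounds\<close>), so such a prefix
  exists.\<close>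

lemma ex1_sorted_key_list:
  fixes f :: "'a \<Rightarrow> 'b::linorder"
  assumes "finite A" and "inj_on f A"
  shows "\<exists>!xs. distinct xs \<and> set xs = A \<and> sorted (map f xs)"
proof (rule ex_ex1I)
  obtain xs where "distinct xs" "set xs = A"
    using finite_distinct_list[OF assms(1)] by blast
  then have "distinct (sort_key f xs) \<and> set (sort_key f xs) = A \<and> sorted (map f (sort_key f xs))"
    by simp
  then show "\<exists>xs. distinct xs \<and> set xs = A \<and> sorted (map f xs)" ..
next
  fix xs ys
  assume "distinct xs \<and> set xs = A \<and> sorted (map f xs)"
    and "distinct ys \<and> set ys = A \<and> sorted (map f ys)"
  then show "xs = ys"
    using map_sorted_distinct_set_unique[of f xs ys] assms(2) by (simp add: distinct_map)
qed

lemma tied_iff: "tied C \<longleftrightarrow> (\<forall>p\<in>C. \<forall>q\<in>C. tie_key p = tie_key q)"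
  by (simp add: tied_def tie_key_def)

text \<open>Maximality does the work: the fibre of \<open>tie_key\<close> through p is itself tied
  and contains C.\<close>

lemma tie_cohort_eq:
  assumes "C \<in> tie_cohorts P" and "p \<in> C"
  shows "C = {q \<in> P. tie_key q = tie_key p}"
proof -
  let ?D = "{q \<in> P. tie_key q = tie_key p}"
  have "C \<subseteq> P" "tied C" and max: "\<And>D. C \<subseteq> D \<Longrightarrow> D \<subseteq> P \<Longrightarrow> tied D \<Longrightarrow> D = C"
    using assms(1) by (auto simp: tie_cohorts_def)
  then have "C \<subseteq> ?D"
    using assms(2) unfolding tied_iff by blast
  moreover have "tied ?D"
    by (simp add: tied_iff)
  ultimately show ?thesis
    using max[of ?D] by blast
qed

text \<open>The common tie key of a cohort. \<open>the_elem\<close> is meaningful because the image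
  of a cohort is a singleton.\<close>

definition cohort_key :: "('q, 'd, 'i) position set \<Rightarrow> real \<times> 'd" where
  "cohort_key C = the_elem (tie_key ` C)"

lemma cohort_key_eq:
  assumes "C \<in> tie_cohorts P" and "p \<in> C"
  shows "cohort_key C = tie_key p"
proof -
  have "tie_key ` C = {tie_key p}"
    using tie_cohort_eq[OF assms] assms(2) by auto
  then show ?thesis
    by (simp add: cohort_key_def)
qed

lemma tie_cohort_nonempty: "C \<in> tie_cohorts P \<Longrightarrow> \<exists>p. p \<in> C"
  by (auto simp: tie_cohorts_def)

lemma inj_on_cohort_key: "inj_on cohort_key (tie_cohorts P)"
proof (rule inj_onI)
  fix C D :: "('a, 'b, 'c) position set"
  assume C: "C \<in> tie_cohorts P" and D: "D \<in> tie_cohorts P" and eq: "cohort_key C = cohort_key D"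
  obtain p q where "p \<in> C" "q \<in> D"
    using C D tie_cohort_nonempty by blast
  moreover from this have "tie_key p = tie_key q"
    using C D eq by (simp add: cohort_key_eq)
  ultimately show "C = D"
    using tie_cohort_eq[OF C, of p] tie_cohort_eq[OF D, of q] by simp
qed

lemma finite_tie_cohorts: "finite P \<Longrightarrow> finite (tie_cohorts P)"
  by (rule finite_subset[of _ "Pow P"]) (auto simp: tie_cohorts_def)

text \<open>Brings cohort sequences into the form treated by \<open>ex1_sorted_key_list\<close>:
  comparing all members of two cohorts amounts to comparing their common keys.\<close>

lemma cohort_sequence_iff:
  "cohort_sequence P Cs \<longleftrightarrow>
     distinct Cs \<and> set Cs = tie_cohorts P \<and> sorted (map cohort_key Cs)"
proof -
  have key_le: "(\<forall>p\<in>C. \<forall>q\<in>D. tie_key p \<le> tie_key q) \<longleftrightarrow> cohort_key C \<le> cohort_key D"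
    if C: "C \<in> tie_cohorts P" and D: "D \<in> tie_cohorts P" for C D
  proof -
    have "(\<forall>p\<in>C. \<forall>q\<in>D. tie_key p \<le> tie_key q) \<longleftrightarrow>
        (\<forall>p\<in>C. \<forall>q\<in>D. cohort_key C \<le> cohort_key D)"
      using cohort_key_eq[OF C] cohort_key_eq[OF D] by simp
    then show ?thesis
      using tie_cohort_nonempty[OF C] tie_cohort_nonempty[OF D] by blast
  qed
  have "sorted_wrt (\<lambda>C D. \<forall>p\<in>C. \<forall>q\<in>D. tie_key p \<le> tie_key q) Cs \<longleftrightarrow>
      sorted (map cohort_key Cs)" if "set Cs = tie_cohorts P"
    \<comment> \<open>The two relations agree only on cohorts, which suffices since every entry of
      \<open>Cs\<close> is one.\<close>
    unfolding sorted_map using that key_le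
    by (intro iffI; elim sorted_wrt_mono_rel[rotated]) simp_all
  then show ?thesis
    unfolding cohort_sequence_def by blast
qed

text \<open>The targets sum to exactly n, and rounding a nonnegative target down loses between 0 and
  1 lot.\<close>

lemma base_lots_bounds:
  assumes "finite C" and "\<And>p. p \<in> C \<Longrightarrow> 0 \<le> debt_service_requirement p"
    and "0 < (\<Sum>p\<in>C. debt_service_requirement p)"
  shows "(\<Sum>p\<in>C. base_lots n C p) \<le> n"
    and "n \<le> (\<Sum>p\<in>C. base_lots n C p) + card C"
proof -
  have total: "(\<Sum>p\<in>C. pro_rata_target n C p) = real n"
    using assms(3)
    unfolding pro_rata_target_def sum_divide_distrib[symmetric] sum_distrib_left[symmetric] by simp
  have nonneg: "0 \<le> pro_rata_target n C p" if "p \<in> C" for p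
    using assms that by (simp add: pro_rata_target_def)
  have "(\<Sum>p\<in>C. real (base_lots n C p)) \<le> (\<Sum>p\<in>C. pro_rata_target n C p)"
    using nonneg by (intro sum_mono) (simp add: base_lots_def)
  then have "real (\<Sum>p\<in>C. base_lots n C p) \<le> real n"
    unfolding total by simp
  then show "(\<Sum>p\<in>C. base_lots n C p) \<le> n"
    by (simp only: of_nat_le_iff)
  \<comment> \<open>This holds for every p, even outside C: \<open>nat\<close> can only raise the
    floor.\<close>
  have "pro_rata_target n C p \<le> real (base_lots n C p) + 1" for p
    unfolding base_lots_def by linarith
  then have "(\<Sum>p\<in>C. pro_rata_target n C p) \<le> (\<Sum>p\<in>C. real (base_lots n C p) + 1)"
    by (intro sum_mono)
  then have "real n \<le> real ((\<Sum>p\<in>C. base_lots n C p) + card C)"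
    unfolding total by (simp add: sum.distrib)
  then show "n \<le> (\<Sum>p\<in>C. base_lots n C p) + card C"
    by (simp only: of_nat_le_iff)
qed

text \<open>A prefix of a fixed list is determined by its length, and the lot count fixes that
  length.\<close>

lemma ex1_residual_assignment:
  assumes "finite C" and "inj_on position_id C"
    and "\<And>p. p \<in> C \<Longrightarrow> 0 \<le> debt_service_requirement p"
    and "0 < (\<Sum>p\<in>C. debt_service_requirement p)"
  shows "\<exists>!rs. residual_assignment n C rs"
proof -
  obtain xs where xs: "identifier_order C xs" and uniq: "\<And>ys. identifier_order C ys \<Longrightarrow> ys = xs"
    using ex1_sorted_key_list[OF assms(1,2)] unfolding identifier_order_def by blast
  \<comment> \<open>The number of residual lots; the natural-number subtraction does not truncate,
    by the first bound of \<open>base_lots_bounds\<close>.\<close>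
  define k where "k = n - (\<Sum>p\<in>C. base_lots n C p)"
  have "length xs = card C"
    using xs by (auto simp: identifier_order_def distinct_card)
  then have k: "(\<Sum>p\<in>C. base_lots n C p) + k = n" "k \<le> length xs"
    using base_lots_bounds[OF assms(1,3,4), of n] by (simp_all add: k_def)
  show ?thesis
  proof (rule ex1I)
    show "residual_assignment n C (take k xs)"
      using k xs by (auto simp: residual_assignment_def take_is_prefix)
  next
    fix rs
    assume "residual_assignment n C rs"
    then have "length rs = k" "prefix rs xs"
      using k(1) uniq by (auto simp: residual_assignment_def)
    then show "rs = take k xs"
      by (auto simp: prefix_def)
  qed
qed

theorem proposition8p5:
  fixes P :: "('q, 'd::linorder, 'i::linorder) position set"
  assumes "finite P"
    and "\<And>p. p \<in> P \<Longrightarrow> debt_service_ub p + buffer p \<noteq> 0"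
    and "inj_on position_id P"
  shows "(\<exists>!xs. execution_order P xs) \<and>
    (\<exists>!Cs. cohort_sequence P Cs) \<and>
    (\<forall>C\<in>tie_cohorts P. \<forall>n.
       (\<forall>p\<in>C. 0 \<le> debt_service_requirement p) \<and> 0 < (\<Sum>p\<in>C. debt_service_requirement p) \<longrightarrow>
       (\<exists>!rs. residual_assignment n C rs))"
proof (intro conjI ballI allI impI)
  have "inj_on canonical_key P"
    using assms(3) by (auto simp: inj_on_def canonical_key_def)
  with assms(1) show "\<exists>!xs. execution_order P xs"
    unfolding execution_order_def by (rule ex1_sorted_key_list)
  show "\<exists>!Cs. cohort_sequence P Cs"
    unfolding cohort_sequence_iff
    using finite_tie_cohorts[OF assms(1)] inj_on_cohort_key by (rule ex1_sorted_key_list)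
next
  fix C n
  assume "C \<in> tie_cohorts P"
    and "(\<forall>p\<in>C. 0 \<le> debt_service_requirement p) \<and> 0 < (\<Sum>p\<in>C. debt_service_requirement p)"
  moreover from this have "C \<subseteq> P"
    by (simp add: tie_cohorts_def)
  ultimately show "\<exists>!rs. residual_assignment n C rs"
    using assms(1,3) by (intro ex1_residual_assignment) (auto intro: finite_subset inj_on_subset)
qed

end
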